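(* Let $X$ be a Banach space over $\mathbb{K}\in\{\mathbb{R},\mathbb{C}\}$. For a continuous cotranslation $Z:\mathbb{K}\times\mathbb{K}\to\mathbb{A}_X$, the following statements are equivalent: (i) $t\mapsto Z(r,t)$ is derivable at $t=0$, for every $r\in\mathbb{K}$; (ii) $t\mapsto Z(r,t)$ is derivable for every $r\in\mathbb{K}$. Moreover, each one of them implies the following statements, which are equivalent to each other: (iii) $r\mapsto Z(r,t)$ is derivable at $r=0$, for every $t\in\mathbb{K}$; (iv) $r\mapsto Z(r,t)$ is derivable for every $t\in\mathbb{K}$.
   Context: $\mathbb{B}_X$ is the algebra of all continuous linear operators on $X$ with the strong (operator) topology; $\mathbb{A}_X$ is the group of invertible elements of $\mathbb{B}_X$ whose inverse is in $\mathbb{B}_X$. A cotranslation $Z:\mathbb{K}\times\mathbb{K}\to\mathbb{A}_X$ (for the additive group $\mathbb{K}$) is a map with $Z(r,t+s)=Z(r+s,t)Z(r,s)$ for all $r,s,t\in\mathbb{K}$. A map $\psi:\mathbb{K}\to\mathbb{B}_X$ is derivable at $u$ if $\lim_{h\to0}\frac{\psi(u+h)-\psi(u)}{h}$ exists (in the strong topology), and derivable if it is derivable at every $u\in\mathbb{K}$. *)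

theory Defs
  imports "HOL-Analysis.Analysis"
begin

text \<open>
  The scalar field is a type of the following class. Its models are exactly \<open>\<real>\<close> and \<open>\<complex>\<close>:
  either every scalar is real, or the field is spanned over the reals by \<open>1\<close> and a square
  root \<open>j\<close> of \<open>- 1\<close>; multiplicativity of the norm then forces it to be the usual absolute value.
\<close>

class real_or_complex = real_normed_field +
  assumes real_or_complex:
    "(\<forall>x. \<exists>a. x = scaleR a 1) \<or>
     (\<exists>j. j * j = - 1 \<and> (\<forall>x. \<exists>a b. x = scaleR a 1 + scaleR b j))"

instance real :: real_or_complex
  by standard simp

instance complex :: real_or_complex
proof
  have "\<exists>a b. x = scaleR a 1 + scaleR b \<i>" for x :: complex
    by (rule exI[of _ "Re x"], rule exI[of _ "Im x"]) (simp add: complex_eq_iff)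
  then show "(\<forall>x::complex. \<exists>a. x = scaleR a 1) \<or>
     (\<exists>j::complex. j * j = - 1 \<and> (\<forall>x. \<exists>a b. x = scaleR a 1 + scaleR b j))"
    by (metis i_squared)
qed

text \<open>
  A Banach space over the scalar field: the class \<open>banach\<close> supplies the complete norm and
  the underlying real vector space, \<open>smul\<close> the multiplication by scalars.
\<close>

locale scalar_banach_space = vector_space smul
  for smul :: "'k::real_or_complex \<Rightarrow> 'x::banach \<Rightarrow> 'x" +
  assumes norm_scale: "norm (smul c x) = norm c * norm x"
    and scale_of_real: "smul (of_real a) x = a *\<^sub>R x"

lemma scalar_banach_space_scaleR:
  "scalar_banach_space (scaleR :: real \<Rightarrow> 'x::banach \<Rightarrow> 'x)"
  by unfold_locales (simp_all add: algebra_simps)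

lemma scalar_banach_space_complex_times:
  "scalar_banach_space ((*) :: complex \<Rightarrow> complex \<Rightarrow> complex)"
  by unfold_locales (simp_all add: algebra_simps norm_mult scaleR_conv_of_real)

text \<open>
  The type \<open>'x \<Rightarrow>\<^sub>L 'x\<close> consists of the continuous real-linear operators; those that are
  linear over the scalar field are singled out inside it.
\<close>

definition operators :: "('k \<Rightarrow> 'x \<Rightarrow> 'x) \<Rightarrow> ('x::real_normed_vector \<Rightarrow>\<^sub>L 'x) set" where
  "operators smul = {T. \<forall>c x. blinfun_apply T (smul c x) = smul c (blinfun_apply T x)}"

definition operator_topology :: "('k \<Rightarrow> 'x \<Rightarrow> 'x) \<Rightarrow> ('x::real_normed_vector \<Rightarrow>\<^sub>L 'x) topology" where
  "operator_topology smul = subtopology strong_operator_topology (operators smul)"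

definition invertible_operators :: "('k \<Rightarrow> 'x \<Rightarrow> 'x) \<Rightarrow> ('x::real_normed_vector \<Rightarrow>\<^sub>L 'x) set" where
  "invertible_operators smul =
     {T \<in> operators smul. \<exists>S \<in> operators smul.
        T o\<^sub>L S = id_blinfun \<and> S o\<^sub>L T = id_blinfun}"

definition cotranslation ::
    "('k::ab_group_add \<Rightarrow> 'x \<Rightarrow> 'x) \<Rightarrow> ('k \<Rightarrow> 'k \<Rightarrow> ('x::real_normed_vector \<Rightarrow>\<^sub>L 'x)) \<Rightarrow> bool" where
  "cotranslation smul Z \<longleftrightarrow>
     (\<forall>r t. Z r t \<in> invertible_operators smul) \<and>
     (\<forall>r s t. Z r (t + s) = Z (r + s) t o\<^sub>L Z r s)"

text \<open>Joint continuity of \<open>Z\<close> on the product of the scalar field with itself.\<close>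

definition continuous_cotranslation ::
    "('k::{ab_group_add,topological_space} \<Rightarrow> 'x \<Rightarrow> 'x) \<Rightarrow>
     ('k \<Rightarrow> 'k \<Rightarrow> ('x::real_normed_vector \<Rightarrow>\<^sub>L 'x)) \<Rightarrow> bool" where
  "continuous_cotranslation smul Z \<longleftrightarrow>
     cotranslation smul Z \<and>
     continuous_map euclidean
       (subtopology (operator_topology smul) (invertible_operators smul)) (\<lambda>(r, t). Z r t)"

definition scale_operator ::
    "('k \<Rightarrow> 'x \<Rightarrow> 'x) \<Rightarrow> 'k \<Rightarrow> ('x::real_normed_vector \<Rightarrow>\<^sub>L 'x) \<Rightarrow> ('x \<Rightarrow>\<^sub>L 'x)" where
  "scale_operator smul c T = Blinfun (\<lambda>x. smul c (blinfun_apply T x))"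

text \<open>The function passed to \<open>Blinfun\<close> is indeed bounded linear:\<close>

lemma (in scalar_banach_space) scale_operator_apply:
  "blinfun_apply (scale_operator smul c T) x = smul c (blinfun_apply T x)"
proof -
  have "smul c (a *\<^sub>R y) = a *\<^sub>R smul c y" for a y
    by (metis scale_of_real scale_left_commute)
  then have "bounded_linear (\<lambda>y. smul c y)"
    by (intro bounded_linear_intro[where K = "norm c"])
      (simp_all add: scale_right_distrib norm_scale mult.commute)
  then have "bounded_linear (\<lambda>y. smul c (blinfun_apply T y))"
    by (rule bounded_linear_compose) (rule blinfun.bounded_linear_right)
  then show ?thesis
    by (simp add: scale_operator_def bounded_linear_Blinfun_apply)
qed

definition derivable_at ::
    "('k::real_normed_field \<Rightarrow> 'x \<Rightarrow> 'x) \<Rightarrow> ('k \<Rightarrow> ('x::real_normed_vector \<Rightarrow>\<^sub>L 'x)) \<Rightarrow> 'k \<Rightarrow> bool" where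
  "derivable_at smul \<psi> u \<longleftrightarrow>
     (\<exists>D. limitin (operator_topology smul)
            (\<lambda>h. scale_operator smul (1 / h) (\<psi> (u + h) - \<psi> u)) D (at 0))"

definition derivable ::
    "('k::real_normed_field \<Rightarrow> 'x \<Rightarrow> 'x) \<Rightarrow> ('k \<Rightarrow> ('x::real_normed_vector \<Rightarrow>\<^sub>L 'x)) \<Rightarrow> bool" where
  "derivable smul \<psi> \<longleftrightarrow> (\<forall>u. derivable_at smul \<psi> u)"

end

theory Submission
  imports Defs
begin

text \<open>
  From \<open>Z 0 (t + r) = Z r t \<circ> Z 0 r\<close> one gets \<open>Z r t = Z 0 (r + t) \<circ> (Z 0 r)\<inverse>\<close>, and
  similarly \<open>Z (h + u) t = Z h (t + u) \<circ> (Z h u)\<inverse>\<close>, where \<open>(Z r t)\<inverse> = Z (r + t) (- t)\<close>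
  is again continuous. So derivability spreads from one point to all others by the product rule
  and the rule for inverses. In the strong topology both rules rest on the uniform boundedness
  principle: composition is jointly sequentially continuous.
\<close>

section \<open>Uniform boundedness and limits in the strong topology\<close>

text \<open>Baire category argument: the closed sets \<open>A n\<close> cover the space, so one of
  them contains a ball, and a bound on a ball of radius \<open>e\<close> rescales to a bound on the
  operator norms.\<close>

theorem uniform_boundedness:
  fixes T :: "'i \<Rightarrow> 'a::banach \<Rightarrow>\<^sub>L 'b::real_normed_vector"
  assumes "\<And>x. bounded (range (\<lambda>i. T i x))"
  shows "bounded (range T)"
proof -
  define A where "A n = {x. \<forall>i. norm (T i x) \<le> real n}" for n
  have closed_A: "closed (A n)" for n
  proof -
    have "A n = (\<Inter>i. {x. norm (T i x) \<le> real n})"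
      by (auto simp: A_def)
    then show ?thesis
      by (auto intro!: closed_INT closed_Collect_le continuous_intros)
  qed
  have "\<Union>(range A) = UNIV"
  proof safe
    fix x
    obtain B where B: "\<And>i. norm (T i x) \<le> B"
      using assms[of x] by (auto simp: bounded_iff)
    obtain n where "B \<le> real n"
      using real_arch_simple by blast
    then have "x \<in> A n"
      using B by (auto simp: A_def intro: order_trans)
    then show "x \<in> \<Union>(range A)" by blast
  qed simp
  \<comment> \<open>Baire: in a complete space, countably many closed sets with empty interior have
    a union with empty interior; here the union is everything.\<close>
  moreover have "interior (\<Union>(range A)) = {}" if "\<And>n. interior (A n) = {}"
    using Met_TC.metric_Baire_category_alt[where \<G> = "range A"] closed_A that
    by (auto simp: complete_UNIV)
  ultimately obtain n where "interior (A n) \<noteq> {}"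
    by (metis interior_UNIV UNIV_not_empty)
  then obtain x0 e where e: "e > 0" and cball: "cball x0 e \<subseteq> A n"
    by (meson ex_in_conv mem_interior_cball)
  have "norm (T i) \<le> 2 * real n / e" for i
  proof (rule norm_blinfun_bound)
    fix x
    show "norm (T i x) \<le> 2 * real n / e * norm x"
    proof (cases "x = 0")
      case False
      \<comment> \<open>Rescaling \<open>x\<close> to norm \<open>e\<close> keeps
        \<open>x0 + y\<close> in the ball; \<open>T i y\<close> is then a difference of two values
        of norm at most \<open>n\<close>, whence the factor 2.\<close>
      define y where "y = (e / norm x) *\<^sub>R x"
      have "norm y = e"
        using False e by (simp add: y_def)
      then have "x0 + y \<in> A n" "x0 \<in> A n"
        using cball e by (auto simp: dist_norm)
      then have "norm (T i (x0 + y)) \<le> n" "norm (T i x0) \<le> n"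
        by (auto simp: A_def)
      moreover have "T i y = T i (x0 + y) - T i x0"
        by (simp add: blinfun.add_right)
      ultimately have "norm (T i y) \<le> 2 * real n"
        using norm_triangle_ineq4[of "T i (x0 + y)" "T i x0"] by simp
      moreover have "norm (T i y) = e / norm x * norm (T i x)"
        using e by (simp add: y_def blinfun.scaleR_right)
      ultimately show ?thesis
        using False e by (simp add: field_simps)
    qed simp
  qed (use e in simp)
  then show ?thesis
    by (auto simp: bounded_iff)
qed

text \<open>Split \<open>T k (y k) = T k (y k - y0) + T k y0\<close>. The first term vanishes in the
  limit once the norms of \<open>T k\<close> are bounded. First countability reduces the claim to
  sequences, where pointwise convergence gives pointwise bounds and uniform boundedness
  applies.\<close>

lemma strong_limit_apply:
  fixes T :: "'k::first_countable_topology \<Rightarrow> 'a::banach \<Rightarrow>\<^sub>L 'b::real_normed_vector"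
  assumes T: "\<And>x. ((\<lambda>k. T k x) \<longlongrightarrow> T0 x) (at u)" and y: "(y \<longlongrightarrow> y0) (at u)"
  shows "((\<lambda>k. T k (y k)) \<longlongrightarrow> T0 y0) (at u)"
  unfolding tendsto_at_iff_sequentially comp_def
proof (intro allI impI)
  fix X assume X: "\<forall>i. X i \<in> UNIV - {u}" "X \<longlonglongrightarrow> u"
  have TX: "(\<lambda>i. T (X i) x) \<longlonglongrightarrow> T0 x" for x
    using T[of x] X unfolding tendsto_at_iff_sequentially comp_def by blast
  have yX: "(\<lambda>i. y (X i)) \<longlonglongrightarrow> y0"
    using y X unfolding tendsto_at_iff_sequentially comp_def by blast
  have "bounded (range (\<lambda>i. T (X i)))"
    by (rule uniform_boundedness) (use TX convergent_imp_bounded in blast)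
  then have "Bfun (\<lambda>i. T (X i)) sequentially"
    by (simp add: Bseq_eq_bounded)
  moreover have "Zfun (\<lambda>i. y (X i) - y0) sequentially"
    using yX by (simp add: tendsto_Zfun_iff)
  ultimately have "(\<lambda>i. T (X i) (y (X i) - y0)) \<longlonglongrightarrow> 0"
    using bounded_bilinear.Bfun_prod_Zfun[OF bounded_bilinear_blinfun_apply]
    by (simp add: tendsto_Zfun_iff)
  from tendsto_add[OF this TX[of y0]]
  show "(\<lambda>i. T (X i) (y (X i))) \<longlonglongrightarrow> T0 y0"
    by (simp add: blinfun.diff_right)
qed

text \<open>The strong topology is pulled back from the product topology on functions, whose limits
  are taken coordinatewise.\<close>

lemma limitin_strong_operator_topology:
  "limitin strong_operator_topology f l F \<longleftrightarrow> (\<forall>x. ((\<lambda>k. blinfun_apply (f k) x) \<longlongrightarrow> l x) F)"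
proof
  assume "limitin strong_operator_topology f l F"
  from continuous_map_limit[OF strong_operator_topology_continuous_evaluation this]
  show "\<forall>x. ((\<lambda>k. blinfun_apply (f k) x) \<longlongrightarrow> l x) F"
    by (simp add: comp_def)
next
  assume *: "\<forall>x. ((\<lambda>k. blinfun_apply (f k) x) \<longlongrightarrow> l x) F"
  have "limitin (product_topology (\<lambda>_. euclidean) UNIV) (\<lambda>k. blinfun_apply (f k)) (blinfun_apply l) F"
    using * by (simp add: limitin_componentwise)
  then have "((\<lambda>k. blinfun_apply (f k)) \<longlongrightarrow> blinfun_apply l) F"
    by (simp add: euclidean_product_topology)
  then show "limitin strong_operator_topology f l F"
    by (auto simp: limitin_def strong_operator_topology_def topspace_pullback_topology
        openin_pullback_topology tendsto_def)
qed

section \<open>Differentiation of operator-valued maps\<close>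

lemma operators_apply: "T \<in> operators smul \<Longrightarrow> T (smul c x) = smul c (T x)"
  by (simp add: operators_def)

lemma operators_compose:
  "S \<in> operators smul \<Longrightarrow> T \<in> operators smul \<Longrightarrow> S o\<^sub>L T \<in> operators smul"
  by (simp add: operators_def)

context scalar_banach_space
begin

lemma operators_zero: "0 \<in> operators smul"
  by (simp add: operators_def)

lemma operators_add:
  "S \<in> operators smul \<Longrightarrow> T \<in> operators smul \<Longrightarrow> S + T \<in> operators smul"
  by (simp add: operators_def blinfun.add_left scale_right_distrib)

lemma operators_uminus: "T \<in> operators smul \<Longrightarrow> - T \<in> operators smul"
  by (simp add: operators_def blinfun.minus_left)

lemma operators_diff:
  "S \<in> operators smul \<Longrightarrow> T \<in> operators smul \<Longrightarrow> S - T \<in> operators smul"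
  by (simp add: operators_def blinfun.diff_left scale_right_diff_distrib)

lemma operators_scale: "T \<in> operators smul \<Longrightarrow> scale_operator smul c T \<in> operators smul"
  by (simp add: operators_def scale_operator_apply mult.commute)

text \<open>The difference quotients stay in \<open>operators smul\<close>, so the subspace topology
  only constrains the limit \<open>D\<close>; the rest is pointwise convergence.\<close>

lemma derivable_at_iff:
  assumes "\<And>k. \<psi> k \<in> operators smul"
  shows "derivable_at smul \<psi> u \<longleftrightarrow>
    (\<exists>D\<in>operators smul. \<forall>x. ((\<lambda>h. smul (1 / h) (\<psi> (u + h) x - \<psi> u x)) \<longlongrightarrow> D x) (at 0))"
  by (auto simp: derivable_at_def operator_topology_def limitin_subtopology
      limitin_strong_operator_topology scale_operator_apply blinfun.diff_left
      assms operators_scale operators_diff)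

lemma derivable_at_shift: "derivable_at smul \<psi> u \<longleftrightarrow> derivable_at smul (\<lambda>h. \<psi> (u + h)) 0"
  by (simp add: derivable_at_def)

lemma derivable_at_const:
  assumes "T \<in> operators smul"
  shows "derivable_at smul (\<lambda>_. T) u"
  using assms operators_zero by (auto simp: derivable_at_iff intro!: bexI[of _ 0])

text \<open>Product rule, with derivative
  \<open>(\<phi> u o\<^sub>L E) + (D o\<^sub>L \<psi> u)\<close>. In the term
  \<open>\<phi> (u + h)\<close> applied to the quotient of \<open>\<psi>\<close>, operator and
  argument both vary, which is where \<open>strong_limit_apply\<close> enters.\<close>

lemma derivable_at_compose:
  assumes \<phi>: "\<And>k. \<phi> k \<in> operators smul" and \<psi>: "\<And>k. \<psi> k \<in> operators smul"
    and cont: "\<And>x. isCont (\<lambda>k. \<phi> k x) u"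
    and "derivable_at smul \<phi> u" "derivable_at smul \<psi> u"
  shows "derivable_at smul (\<lambda>k. \<phi> k o\<^sub>L \<psi> k) u"
proof -
  obtain D E where D: "D \<in> operators smul"
      "\<And>x. ((\<lambda>h. smul (1 / h) (\<phi> (u + h) x - \<phi> u x)) \<longlongrightarrow> D x) (at 0)"
    and E: "E \<in> operators smul"
      "\<And>x. ((\<lambda>h. smul (1 / h) (\<psi> (u + h) x - \<psi> u x)) \<longlongrightarrow> E x) (at 0)"
    using assms by (auto simp: derivable_at_iff)
  have lim: "((\<lambda>h. \<phi> (u + h) x) \<longlongrightarrow> \<phi> u x) (at 0)" for x
    using cont by (simp add: isCont_iff)
  have "((\<lambda>h. \<phi> (u + h) (smul (1 / h) (\<psi> (u + h) x - \<psi> u x))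
      + smul (1 / h) (\<phi> (u + h) (\<psi> u x) - \<phi> u (\<psi> u x))) \<longlongrightarrow> \<phi> u (E x) + D (\<psi> u x)) (at 0)" for x
    by (rule tendsto_add[OF strong_limit_apply[OF lim E(2)] D(2)])
  \<comment> \<open>Scalar linearity pulls \<open>1 / h\<close> out of
    \<open>\<phi> (u + h)\<close>; the mixed terms \<open>\<phi> (u + h) (\<psi> u x)\<close>
    cancel.\<close>
  moreover have "\<phi> (u + h) (smul (1 / h) (\<psi> (u + h) x - \<psi> u x))
      + smul (1 / h) (\<phi> (u + h) (\<psi> u x) - \<phi> u (\<psi> u x))
      = smul (1 / h) (\<phi> (u + h) (\<psi> (u + h) x) - \<phi> u (\<psi> u x))" for x h
    by (simp add: operators_apply[OF \<phi>] blinfun.diff_right scale_right_diff_distrib)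
  ultimately have "((\<lambda>h. smul (1 / h) (\<phi> (u + h) (\<psi> (u + h) x) - \<phi> u (\<psi> u x)))
      \<longlongrightarrow> ((\<phi> u o\<^sub>L E) + (D o\<^sub>L \<psi> u)) x) (at 0)" for x
    by (simp add: blinfun.add_left)
  moreover have "(\<phi> u o\<^sub>L E) + (D o\<^sub>L \<psi> u) \<in> operators smul"
    by (intro operators_add operators_compose \<phi> \<psi> D E)
  ultimately show ?thesis
    by (subst derivable_at_iff) (auto intro: operators_compose \<phi> \<psi>)
qed

text \<open>Rests on \<open>\<psi> (u + h) - \<psi> u = - \<psi> (u + h) (\<phi> (u + h) - \<phi> u)
  \<psi> u\<close>, read as composition. Continuity of \<open>\<psi>\<close> is a hypothesis because
  inversion need not be continuous in the strong topology.\<close>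

lemma derivable_at_inverse:
  assumes \<phi>: "\<And>k. \<phi> k \<in> operators smul" and \<psi>: "\<And>k. \<psi> k \<in> operators smul"
    and left: "\<And>k. \<psi> k o\<^sub>L \<phi> k = id_blinfun" and right: "\<And>k. \<phi> k o\<^sub>L \<psi> k = id_blinfun"
    and cont: "\<And>x. isCont (\<lambda>k. \<psi> k x) u"
    and "derivable_at smul \<phi> u"
  shows "derivable_at smul \<psi> u"
proof -
  obtain D where D: "D \<in> operators smul"
      "\<And>x. ((\<lambda>h. smul (1 / h) (\<phi> (u + h) x - \<phi> u x)) \<longlongrightarrow> D x) (at 0)"
    using assms by (auto simp: derivable_at_iff)
  have inv: "\<psi> k (\<phi> k x) = x" "\<phi> k (\<psi> k x) = x" for k x
    using left[of k] right[of k] by (metis blinfun_apply_blinfun_compose id_blinfun.rep_eq)+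
  have lim: "((\<lambda>h. \<psi> (u + h) x) \<longlongrightarrow> \<psi> u x) (at 0)" for x
    using cont by (simp add: isCont_iff)
  have "((\<lambda>h. - \<psi> (u + h) (smul (1 / h) (\<phi> (u + h) (\<psi> u x) - \<phi> u (\<psi> u x))))
      \<longlongrightarrow> - \<psi> u (D (\<psi> u x))) (at 0)" for x
    by (rule tendsto_minus[OF strong_limit_apply[OF lim D(2)]])
  moreover have "- \<psi> (u + h) (smul (1 / h) (\<phi> (u + h) (\<psi> u x) - \<phi> u (\<psi> u x)))
      = smul (1 / h) (\<psi> (u + h) x - \<psi> u x)" for x h
    by (simp add: operators_apply[OF \<psi>] blinfun.diff_right inv scale_right_diff_distrib)
  ultimately have "((\<lambda>h. smul (1 / h) (\<psi> (u + h) x - \<psi> u x))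
      \<longlongrightarrow> (- (\<psi> u o\<^sub>L D o\<^sub>L \<psi> u)) x) (at 0)" for x
    by (simp add: blinfun.minus_left)
  moreover have "- (\<psi> u o\<^sub>L D o\<^sub>L \<psi> u) \<in> operators smul"
    by (intro operators_uminus operators_compose \<psi> D)
  ultimately show ?thesis
    by (subst derivable_at_iff) (auto intro: \<psi>)
qed

end

section \<open>Algebra and continuity of cotranslations\<close>

lemma cotranslation_operators: "cotranslation smul Z \<Longrightarrow> Z r t \<in> operators smul"
  by (simp add: cotranslation_def invertible_operators_def)

lemma cotranslation_compose: "cotranslation smul Z \<Longrightarrow> Z (r + s) t o\<^sub>L Z r s = Z r (t + s)"
  by (simp add: cotranslation_def)

text \<open>\<open>Z r 0\<close> is idempotent, so it fixes its range, and the right inverse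
  \<open>S\<close> makes that range the whole space.\<close>

lemma cotranslation_zero:
  assumes "cotranslation smul Z"
  shows "Z r 0 = id_blinfun"
proof -
  obtain S where "Z r 0 o\<^sub>L S = id_blinfun"
    using assms unfolding cotranslation_def invertible_operators_def by blast
  then have S_apply: "Z r 0 (S x) = x" for x
    by (metis blinfun_apply_blinfun_compose id_blinfun.rep_eq)
  have "Z r 0 o\<^sub>L Z r 0 = Z r 0"
    using cotranslation_compose[OF assms, of r 0 0] by simp
  then have "Z r 0 (Z r 0 (S x)) = Z r 0 (S x)" for x
    by (metis blinfun_apply_blinfun_compose)
  then show ?thesis
    by (intro blinfun_eqI) (simp add: S_apply)
qed

text \<open>Inverses are again values of \<open>Z\<close>, so their continuity comes from that of
  \<open>Z\<close>.\<close>

lemma cotranslation_inverse: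
  assumes "cotranslation smul Z"
  shows "Z (r + t) (- t) o\<^sub>L Z r t = id_blinfun" "Z r t o\<^sub>L Z (r + t) (- t) = id_blinfun"
  using cotranslation_compose[OF assms, of r t "- t"]
    cotranslation_compose[OF assms, of "r + t" "- t" t]
  by (simp_all add: cotranslation_zero[OF assms])

text \<open>Joint continuity lets both arguments move at once, as in
  \<open>Z r (- r)\<close>.\<close>

lemma isCont_cotranslation:
  fixes smul :: "'k::real_normed_field \<Rightarrow> 'x::real_normed_vector \<Rightarrow> 'x"
  assumes Z: "continuous_cotranslation smul Z" and "isCont f u" "isCont g u"
  shows "isCont (\<lambda>k. Z (f k) (g k) x) u"
proof -
  have "continuous_map euclidean strong_operator_topology (\<lambda>(r, t). Z r t)"
    using Z by (simp add: continuous_cotranslation_def operator_topology_def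
        continuous_map_in_subtopology)
  then have "continuous_on UNIV (\<lambda>p. Z (fst p) (snd p) x)"
    by (simp add: continuous_on_strong_operator_topo_iff_coordinatewise case_prod_beta)
  then have "isCont (\<lambda>p. Z (fst p) (snd p) x) (f u, g u)"
    by (simp add: continuous_on_eq_continuous_at)
  from isCont_o2[OF isCont_Pair[OF assms(2,3)] this]
  show ?thesis by simp
qed

theorem corollary4p6:
  fixes smul :: "'k::real_or_complex \<Rightarrow> 'x::banach \<Rightarrow> 'x"
    and Z :: "'k \<Rightarrow> 'k \<Rightarrow> ('x \<Rightarrow>\<^sub>L 'x)"
  assumes "scalar_banach_space smul"
    and "continuous_cotranslation smul Z"
  shows "let
      i = (\<forall>r. derivable_at smul (\<lambda>t. Z r t) 0);
      ii = (\<forall>r. derivable smul (\<lambda>t. Z r t));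
      iii = (\<forall>t. derivable_at smul (\<lambda>r. Z r t) 0);
      iv = (\<forall>t. derivable smul (\<lambda>r. Z r t))
    in (i \<longleftrightarrow> ii) \<and> (i \<or> ii \<longrightarrow> iii \<and> iv) \<and> (iii \<longleftrightarrow> iv)"
proof -
  interpret scalar_banach_space smul by fact
  have Z: "cotranslation smul Z"
    using assms(2) by (simp add: continuous_cotranslation_def)
  note ops = cotranslation_operators[OF Z]
  note cont = isCont_cotranslation[OF assms(2)]
  have i_ii: "derivable smul (\<lambda>t. Z r t)" if "\<And>r. derivable_at smul (\<lambda>t. Z r t) 0" for r
    unfolding derivable_def
  proof
    fix u
    \<comment> \<open>This composite is \<open>Z r (u + h)\<close>. Its right factor is constant in
      \<open>h\<close>, and the left one is derivable at 0 by (i) with base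
      \<open>r + u\<close>.\<close>
    have "derivable_at smul (\<lambda>h. Z (r + u) h o\<^sub>L Z r u) 0"
      by (intro derivable_at_compose derivable_at_const ops cont that) simp_all
    then show "derivable_at smul (\<lambda>t. Z r t) u"
      by (subst derivable_at_shift) (simp add: cotranslation_compose[OF Z] add.commute)
  qed
  have ii_iv: "derivable smul (\<lambda>r. Z r t)" if "\<And>r. derivable smul (\<lambda>t. Z r t)" for t
    unfolding derivable_def
  proof
    fix u
    have U: "derivable_at smul (Z 0) v" for v
      using that by (simp add: derivable_def)
    \<comment> \<open>Shifting both maps to base point 0 turns this into derivability of
      \<open>Z 0\<close> at \<open>t + u\<close>.\<close>
    have "derivable_at smul (\<lambda>r. Z 0 (t + r)) u"
      using U[of "t + u"] derivable_at_shift[of "Z 0" "t + u"]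
        derivable_at_shift[of "\<lambda>r. Z 0 (t + r)" u] by (simp add: add.assoc)
    \<comment> \<open>\<open>Z r (- r)\<close> is the inverse of \<open>Z 0 r\<close>.\<close>
    moreover have "derivable_at smul (\<lambda>r. Z r (- r)) u"
      by (rule derivable_at_inverse[where \<phi> = "Z 0"])
        (use cotranslation_inverse[OF Z, of 0] in \<open>auto intro!: ops cont U\<close>)
    ultimately have "derivable_at smul (\<lambda>r. Z 0 (t + r) o\<^sub>L Z r (- r)) u"
      by (intro derivable_at_compose ops cont) simp_all
    moreover have "Z 0 (t + r) o\<^sub>L Z r (- r) = Z r t" for r
      using cotranslation_compose[OF Z, of r "- r" "t + r"] by simp
    ultimately show "derivable_at smul (\<lambda>r. Z r t) u"
      by simp
  qed
  have iii_iv: "derivable smul (\<lambda>r. Z r t)" if "\<And>t. derivable_at smul (\<lambda>r. Z r t) 0" for t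
    unfolding derivable_def
  proof
    fix u
    \<comment> \<open>This is the inverse of \<open>Z h u\<close>, to which (iii) applies with
      \<open>t = u\<close>; the left factor below uses (iii) with \<open>t + u\<close>.\<close>
    have "derivable_at smul (\<lambda>h. Z (h + u) (- u)) 0"
      by (rule derivable_at_inverse[where \<phi> = "\<lambda>h. Z h u"])
        (auto intro!: ops cont that cotranslation_inverse[OF Z])
    then have "derivable_at smul (\<lambda>h. Z h (t + u) o\<^sub>L Z (h + u) (- u)) 0"
      by (intro derivable_at_compose ops cont that) simp_all
    moreover have "Z h (t + u) o\<^sub>L Z (h + u) (- u) = Z (h + u) t" for h
      using cotranslation_compose[OF Z, of "h + u" "- u" "t + u"] by simp
    ultimately show "derivable_at smul (\<lambda>r. Z r t) u"
      by (subst derivable_at_shift) (simp add: add.commute)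
  qed
  \<comment> \<open>Specializing to 0 gives (ii) to (i) and (iv) to (iii), so (i) yields (iii) by
    way of (ii) and (iv).\<close>
  have "derivable_at smul \<psi> 0" if "derivable smul \<psi>" for \<psi>
    using that by (simp add: derivable_def)
  with i_ii ii_iv iii_iv show ?thesis
    unfolding Let_def by blast
qed

end
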